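(* The Duggal transform of a complex symmetric operator need not be complex symmetric: there exist a separable complex Hilbert space $\mathcal{H}$ and a bounded linear operator $T$ on $\mathcal{H}$ such that $T$ is complex symmetric but its Duggal transform $T^D$ is not complex symmetric.
   Context: A conjugation on a complex Hilbert space $\mathcal{H}$ is an antilinear map $C:\mathcal{H}\to\mathcal{H}$ with $C^2=I$ and $\langle Cx,Cy\rangle=\langle y,x\rangle$ for all $x,y\in\mathcal{H}$. A bounded linear operator $T$ on $\mathcal{H}$ is complex symmetric if there exists a conjugation $C$ on $\mathcal{H}$ such that $T=CT^*C$. The polar decomposition of $T$ is $T=U|T|$, where $|T|=(T^*T)^{1/2}$ and $U$ is the partial isometry with $\ker U=\ker T$. The Duggal transform of $T$ is $T^D=|T|U$. *)

theory Defs
  imports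
    "HOL-Algebra.Algebraic_Closure_Type"
    "HOL-Algebra.Module"
    "HOL-Analysis.Abstract_Metric_Spaces"
    "HOL-Library.Nonpos_Ints"
begin

text \<open>
  Hilbert spaces are records with a carrier, so that one can quantify existentially over them.
  The record extends \<^typ>\<open>('a, 'b) module\<close> of HOL-Algebra; its inherited fields
  \<^const>\<open>monoid.mult\<close> and \<^const>\<open>monoid.one\<close> are not used by \<^locale>\<open>module\<close>
  and carry no meaning here.
\<close>

record 'b inner_module = "(complex, 'b) module" +
  hinner :: "['b, 'b] \<Rightarrow> complex" (\<open>\<langle>_,_\<rangle>\<index>\<close>)

definition hnorm :: "('b, 'm) inner_module_scheme \<Rightarrow> 'b \<Rightarrow> real"
  where "hnorm H x = sqrt (Re \<langle>x,x\<rangle>\<^bsub>H\<^esub>)"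

text \<open>
  The value 0 off the carrier is forced by \<^locale>\<open>Metric_space\<close>, which asks for
  nonnegativity and symmetry on the whole type.
\<close>

definition hdist :: "('b, 'm) inner_module_scheme \<Rightarrow> 'b \<Rightarrow> 'b \<Rightarrow> real"
  where "hdist H x y =
    (if x \<in> carrier H \<and> y \<in> carrier H then hnorm H (x \<ominus>\<^bsub>H\<^esub> y) else 0)"

locale complex_hilbert_space = module "ring_of_type_algebra :: complex ring" H
  for H :: "('b, 'm) inner_module_scheme" (structure) +
  assumes inner_add_left:
      "\<lbrakk>x \<in> carrier H; y \<in> carrier H; z \<in> carrier H\<rbrakk> \<Longrightarrow> \<langle>x \<oplus> y,z\<rangle> = \<langle>x,z\<rangle> + \<langle>y,z\<rangle>"
    and inner_smult_left:
      "\<lbrakk>x \<in> carrier H; y \<in> carrier H\<rbrakk> \<Longrightarrow> \<langle>c \<odot> x,y\<rangle> = c * \<langle>x,y\<rangle>"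
    and inner_commute:
      "\<lbrakk>x \<in> carrier H; y \<in> carrier H\<rbrakk> \<Longrightarrow> \<langle>y,x\<rangle> = cnj \<langle>x,y\<rangle>"
    and inner_nonneg: "x \<in> carrier H \<Longrightarrow> \<langle>x,x\<rangle> \<in> \<real>\<^sub>\<ge>\<^sub>0"
    and inner_definite: "\<lbrakk>x \<in> carrier H; \<langle>x,x\<rangle> = 0\<rbrakk> \<Longrightarrow> x = \<zero>"
    and complete: "Metric_space.mcomplete (carrier H) (hdist H)"

locale separable_complex_hilbert_space = complex_hilbert_space +
  assumes separable: "separable_space (Metric_space.mtopology (carrier H) (hdist H))"

text \<open>
  Operators are extensional functions on the carrier, so that equality of operators is equality
  of functions and the definite descriptions below are meaningful.
\<close>

definition bounded_ops :: "('b, 'm) inner_module_scheme \<Rightarrow> ('b \<Rightarrow> 'b) set"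
  where "bounded_ops H = {T \<in> carrier H \<rightarrow>\<^sub>E carrier H.
    (\<forall>x\<in>carrier H. \<forall>y\<in>carrier H. T (x \<oplus>\<^bsub>H\<^esub> y) = T x \<oplus>\<^bsub>H\<^esub> T y) \<and>
    (\<forall>c. \<forall>x\<in>carrier H. T (c \<odot>\<^bsub>H\<^esub> x) = c \<odot>\<^bsub>H\<^esub> T x) \<and>
    (\<exists>K. \<forall>x\<in>carrier H. hnorm H (T x) \<le> K * hnorm H x)}"

definition adjoint :: "('b, 'm) inner_module_scheme \<Rightarrow> ('b \<Rightarrow> 'b) \<Rightarrow> 'b \<Rightarrow> 'b"
  where "adjoint H T = (THE S. S \<in> bounded_ops H \<and>
    (\<forall>x\<in>carrier H. \<forall>y\<in>carrier H. \<langle>T x,y\<rangle>\<^bsub>H\<^esub> = \<langle>x,S y\<rangle>\<^bsub>H\<^esub>))"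

definition positive_op :: "('b, 'm) inner_module_scheme \<Rightarrow> ('b \<Rightarrow> 'b) \<Rightarrow> bool"
  where "positive_op H P \<longleftrightarrow>
    P \<in> bounded_ops H \<and> (\<forall>x\<in>carrier H. \<langle>P x,x\<rangle>\<^bsub>H\<^esub> \<in> \<real>\<^sub>\<ge>\<^sub>0)"

definition sqrt_op :: "('b, 'm) inner_module_scheme \<Rightarrow> ('b \<Rightarrow> 'b) \<Rightarrow> 'b \<Rightarrow> 'b"
  where "sqrt_op H A = (THE P. positive_op H P \<and> compose (carrier H) P P = A)"

definition abs_op :: "('b, 'm) inner_module_scheme \<Rightarrow> ('b \<Rightarrow> 'b) \<Rightarrow> 'b \<Rightarrow> 'b"
  where "abs_op H T = sqrt_op H (compose (carrier H) (adjoint H T) T)"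

definition ker_op :: "('b, 'm) inner_module_scheme \<Rightarrow> ('b \<Rightarrow> 'b) \<Rightarrow> 'b set"
  where "ker_op H T = {x \<in> carrier H. T x = \<zero>\<^bsub>H\<^esub>}"

definition orth_compl :: "('b, 'm) inner_module_scheme \<Rightarrow> 'b set \<Rightarrow> 'b set"
  where "orth_compl H S = {x \<in> carrier H. \<forall>y\<in>S. \<langle>x,y\<rangle>\<^bsub>H\<^esub> = 0}"

definition partial_isometry :: "('b, 'm) inner_module_scheme \<Rightarrow> ('b \<Rightarrow> 'b) \<Rightarrow> bool"
  where "partial_isometry H U \<longleftrightarrow>
    U \<in> bounded_ops H \<and> (\<forall>x\<in>orth_compl H (ker_op H U). hnorm H (U x) = hnorm H x)"

definition polar_factor :: "('b, 'm) inner_module_scheme \<Rightarrow> ('b \<Rightarrow> 'b) \<Rightarrow> 'b \<Rightarrow> 'b"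
  where "polar_factor H T = (THE U. partial_isometry H U \<and> ker_op H U = ker_op H T \<and>
    T = compose (carrier H) U (abs_op H T))"

definition duggal :: "('b, 'm) inner_module_scheme \<Rightarrow> ('b \<Rightarrow> 'b) \<Rightarrow> 'b \<Rightarrow> 'b"
  where "duggal H T = compose (carrier H) (abs_op H T) (polar_factor H T)"

definition conjugation :: "('b, 'm) inner_module_scheme \<Rightarrow> ('b \<Rightarrow> 'b) \<Rightarrow> bool"
  where "conjugation H C \<longleftrightarrow>
    C \<in> carrier H \<rightarrow> carrier H \<and>
    (\<forall>x\<in>carrier H. \<forall>y\<in>carrier H. C (x \<oplus>\<^bsub>H\<^esub> y) = C x \<oplus>\<^bsub>H\<^esub> C y) \<and>
    (\<forall>c. \<forall>x\<in>carrier H. C (c \<odot>\<^bsub>H\<^esub> x) = cnj c \<odot>\<^bsub>H\<^esub> C x) \<and>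
    (\<forall>x\<in>carrier H. C (C x) = x) \<and>
    (\<forall>x\<in>carrier H. \<forall>y\<in>carrier H. \<langle>C x,C y\<rangle>\<^bsub>H\<^esub> = \<langle>y,x\<rangle>\<^bsub>H\<^esub>)"

definition complex_symmetric :: "('b, 'm) inner_module_scheme \<Rightarrow> ('b \<Rightarrow> 'b) \<Rightarrow> bool"
  where "complex_symmetric H T \<longleftrightarrow>
    (\<exists>C. conjugation H C \<and> (\<forall>x\<in>carrier H. T x = C (adjoint H T (C x))))"

end

theory Submission
  imports Defs
begin

text \<open>
  If W is a symmetric unitary matrix and D a nonnegative diagonal matrix, then T = W D is complex
  symmetric with respect to x \<mapsto> W (cnj x), and the modulus of T is D. The polar factor of T is W P,
  where P is the projection onto the range of D, so the Duggal transform is D W P. On the range of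
  D this is a positive diagonal matrix times a corner of W, which is similar but in general not
  unitarily equivalent to a symmetric matrix. A kernel is essential, since for invertible T the
  Duggal transform is unitarily equivalent to T. In dimension 4, with W the reflection in the
  hyperplane orthogonal to (1,1,1,1) and D = diag(4, 10, 40, 0), a simple eigenvalue and the
  norms of a few vectors exclude complex symmetry.
\<close>

section \<open>The Hilbert space of complex n-tuples\<close>

text \<open>Tuples are sequences padded with zeros, so each vector has one representative, equality
  is equality of functions, and the dimension is an ordinary parameter.\<close>

definition cvec :: "nat \<Rightarrow> (nat \<Rightarrow> complex) inner_module" where
  "cvec n = \<lparr>carrier = {x. \<forall>i\<ge>n. x i = 0}, monoid.mult = \<lambda>x y. x, one = \<lambda>_. 0,
     ring.zero = \<lambda>_. 0, add = \<lambda>x y i. x i + y i, module.smult = \<lambda>c x i. c * x i,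
     hinner = \<lambda>x y. \<Sum>i<n. x i * cnj (y i)\<rparr>"

lemma cvec_sel:
  "x \<in> carrier (cvec n) \<longleftrightarrow> (\<forall>i\<ge>n. x i = 0)"
  "\<zero>\<^bsub>cvec n\<^esub> = (\<lambda>_. 0)"
  "x \<oplus>\<^bsub>cvec n\<^esub> y = (\<lambda>i. x i + y i)"
  "c \<odot>\<^bsub>cvec n\<^esub> x = (\<lambda>i. c * x i)"
  "\<langle>x,y\<rangle>\<^bsub>cvec n\<^esub> = (\<Sum>i<n. x i * cnj (y i))"
  by (simp_all add: cvec_def)

lemma cvec_eqI:
  "\<lbrakk>x \<in> carrier (cvec n); y \<in> carrier (cvec n); \<And>i. i < n \<Longrightarrow> x i = y i\<rbrakk> \<Longrightarrow> x = y"
  unfolding cvec_sel by (metis ext leI)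

lemma module_cvec: "module (ring_of_type_algebra :: complex ring) (cvec n)"
proof (rule moduleI)
  show "cring (ring_of_type_algebra :: complex ring)"
    by (rule cring_from_type_algebra)
  show "abelian_group (cvec n)"
  proof (rule abelian_groupI)
    fix x assume "x \<in> carrier (cvec n)"
    then show "\<exists>y\<in>carrier (cvec n). y \<oplus>\<^bsub>cvec n\<^esub> x = \<zero>\<^bsub>cvec n\<^esub>"
      by (intro bexI[of _ "\<lambda>i. - x i"]) (auto simp: cvec_sel)
  qed (auto simp: cvec_sel add_ac)
qed (auto simp: cvec_sel ring_of_type_algebra_def algebra_simps)

text \<open>Additive inverses in an abelian group are given by a definite description, so the
  pointwise formula rests on their uniqueness.\<close>

lemma cvec_minus:
  assumes "x \<in> carrier (cvec n)" "y \<in> carrier (cvec n)"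
  shows "x \<ominus>\<^bsub>cvec n\<^esub> y = (\<lambda>i. x i - y i)"
proof -
  interpret module "ring_of_type_algebra :: complex ring" "cvec n" by (rule module_cvec)
  have "\<ominus>\<^bsub>cvec n\<^esub> y = (\<lambda>i. - y i)"
    using assms by (intro minus_equality) (auto simp: cvec_sel)
  then show ?thesis by (simp add: a_minus_def cvec_sel)
qed

lemma hinner_cvec_self: "\<langle>x,x\<rangle>\<^bsub>cvec n\<^esub> = of_real (\<Sum>i<n. (cmod (x i))\<^sup>2)"
  by (simp add: cvec_sel complex_norm_square del: of_real_power)

lemma hnorm_cvec: "hnorm (cvec n) x = L2_set (\<lambda>i. cmod (x i)) {..<n}"
  by (simp only: hnorm_def hinner_cvec_self L2_set_def Re_complex_of_real)

lemma hdist_cvec: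
  "\<lbrakk>x \<in> carrier (cvec n); y \<in> carrier (cvec n)\<rbrakk> \<Longrightarrow>
    hdist (cvec n) x y = L2_set (\<lambda>i. dist (x i) (y i)) {..<n}"
  by (simp add: hdist_def hnorm_cvec cvec_minus dist_norm)

lemma Metric_space_cvec: "Metric_space (carrier (cvec n)) (hdist (cvec n))"
proof
  show "0 \<le> hdist (cvec n) x y" for x y
    by (simp add: hdist_def hnorm_cvec)
  show "hdist (cvec n) x y = hdist (cvec n) y x" for x y
    by (cases "x \<in> carrier (cvec n) \<and> y \<in> carrier (cvec n)")
      (auto simp: hdist_cvec dist_commute, auto simp: hdist_def)
next
  fix x y assume xy: "x \<in> carrier (cvec n)" "y \<in> carrier (cvec n)"
  show "hdist (cvec n) x y = 0 \<longleftrightarrow> x = y"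
    using xy by (auto simp: hdist_cvec L2_set_eq_0_iff intro: cvec_eqI)
next
  fix x y z
  assume *: "x \<in> carrier (cvec n)" "y \<in> carrier (cvec n)" "z \<in> carrier (cvec n)"
  have "L2_set (\<lambda>i. dist (x i) (z i)) {..<n}
      \<le> L2_set (\<lambda>i. dist (x i) (y i) + dist (y i) (z i)) {..<n}"
    by (intro L2_set_mono dist_triangle) auto
  also have "\<dots> \<le> L2_set (\<lambda>i. dist (x i) (y i)) {..<n} + L2_set (\<lambda>i. dist (y i) (z i)) {..<n}"
    by (rule L2_set_triangle_ineq)
  finally show "hdist (cvec n) x z \<le> hdist (cvec n) x y + hdist (cvec n) y z"
    using * by (simp add: hdist_cvec)
qed

text \<open>Makes the coordinates of a Cauchy sequence Cauchy.\<close>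

lemma dist_le_hdist_cvec:
  assumes "x \<in> carrier (cvec n)" "y \<in> carrier (cvec n)"
  shows "dist (x i) (y i) \<le> hdist (cvec n) x y"
proof (cases "i < n")
  case True
  then show ?thesis
    using assms by (auto simp: hdist_cvec intro: member_le_L2_set[of _ _ "\<lambda>i. dist (x i) (y i)"])
next
  case False
  then have "x i = y i" using assms by (simp add: cvec_sel)
  then show ?thesis using assms by (simp add: hdist_cvec)
qed

text \<open>Limits are taken coordinatewise. The distance to the limit is at most the finite sum of
  the coordinate distances, which tends to 0.\<close>

lemma mcomplete_cvec: "Metric_space.mcomplete (carrier (cvec n)) (hdist (cvec n))"
proof -
  interpret Metric_space "carrier (cvec n)" "hdist (cvec n)" by (rule Metric_space_cvec)
  have "\<exists>x. limitin mtopology s x sequentially" if s: "MCauchy s" for s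
  proof -
    have sc: "s k \<in> carrier (cvec n)" for k
      using s by (auto simp: MCauchy_def)
    have "Cauchy (\<lambda>k. s k i)" for i
      unfolding Cauchy_def
      using s dist_le_hdist_cvec[OF sc sc] unfolding MCauchy_def by (meson le_less_trans)
    then have "\<exists>l. (\<lambda>k. s k i) \<longlonglongrightarrow> l" for i
      by (simp add: Cauchy_convergent_iff convergent_def)
    then obtain x where x: "\<And>i. (\<lambda>k. s k i) \<longlonglongrightarrow> x i" by metis
    have xc: "x \<in> carrier (cvec n)"
      unfolding cvec_sel
    proof (intro allI impI)
      fix i assume "n \<le> i"
      then have "(\<lambda>k. s k i) = (\<lambda>_. 0)" using sc by (auto simp: cvec_sel)
      then show "x i = 0" using x[of i] by (simp add: LIMSEQ_const_iff)
    qed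
    have "(\<lambda>k. \<Sum>i<n. dist (s k i) (x i)) \<longlonglongrightarrow> (\<Sum>i<n. 0)"
      by (intro tendsto_sum tendsto_dist_iff[THEN iffD1] x)
    then have 0: "(\<lambda>k. \<Sum>i<n. dist (s k i) (x i)) \<longlonglongrightarrow> 0" by simp
    have "hdist (cvec n) (s k) x \<le> (\<Sum>i<n. dist (s k i) (x i))" for k
      using sc xc by (simp add: hdist_cvec L2_set_le_sum)
    then have "(\<lambda>k. hdist (cvec n) (s k) x) \<longlonglongrightarrow> 0"
      by (intro tendsto_sandwich[OF _ _ tendsto_const 0]) auto
    then show ?thesis
      using sc xc by (auto simp: limitin_metric_dist_null)
  qed
  then show ?thesis by (simp add: mcomplete_def)
qed

lemma separable_cvec: "separable_space (Metric_space.mtopology (carrier (cvec n)) (hdist (cvec n)))"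
proof -
  interpret Metric_space "carrier (cvec n)" "hdist (cvec n)" by (rule Metric_space_cvec)
  obtain D :: "complex set" where D: "countable D" "\<And>V. open V \<Longrightarrow> V \<noteq> {} \<Longrightarrow> \<exists>d\<in>D. d \<in> V"
    using countable_dense_exists by metis
  \<comment> \<open>Indexing by finite lists over \<open>D\<close> gives countability at once. Lists
    shorter than \<open>n\<close> contribute unspecified entries, which is harmless: only
    countability, membership in the carrier and density matter.\<close>
  define Q where "Q = (\<lambda>l i. if i < n then l ! i else 0) ` lists D"
  have Q: "countable Q" "Q \<subseteq> carrier (cvec n)"
    using D by (auto simp: Q_def cvec_sel)
  have "\<exists>y\<in>Q. hdist (cvec n) x y < r" if x: "x \<in> carrier (cvec n)" and r: "r > 0" for x r
  proof -
    \<comment> \<open>Dividing by n + 1 rather than n keeps the summed bound strictly below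
      \<open>r\<close> and covers n = 0.\<close>
    have "0 < r / (n + 1)" using r by simp
    then have "\<exists>d\<in>D. d \<in> ball (x i) (r / (n + 1))" for i
      by (intro D(2)) auto
    then have "\<exists>d\<in>D. dist (x i) d < r / (n + 1)" for i
      by (simp only: mem_ball)
    then obtain d where d: "\<And>i. d i \<in> D" "\<And>i. dist (x i) (d i) < r / (n + 1)" by metis
    define y where "y = (\<lambda>i. if i < n then map d [0..<n] ! i else 0)"
    have yQ: "y \<in> Q" unfolding Q_def y_def using d by (intro imageI) auto
    have "hdist (cvec n) x y \<le> (\<Sum>i<n. dist (x i) (y i))"
      using x yQ Q by (subst hdist_cvec) (auto simp: L2_set_le_sum)
    also have "\<dots> \<le> of_nat (card {..<n}) * (r / (n + 1))"
      using d by (intro sum_bounded_above) (auto simp: y_def less_imp_le)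
    also have "\<dots> < r" using r by (simp add: field_simps)
    finally show ?thesis using yQ by auto
  qed
  then have "mtopology closure_of Q = carrier (cvec n)"
    using Q by (auto simp: metric_closure_of subset_iff)
  then show ?thesis
    unfolding separable_space_def using Q by auto
qed

lemma separable_complex_hilbert_space_cvec: "separable_complex_hilbert_space (cvec n)"
proof -
  interpret module "ring_of_type_algebra :: complex ring" "cvec n" by (rule module_cvec)
  show ?thesis
  proof
    fix x assume x: "x \<in> carrier (cvec n)" and "\<langle>x,x\<rangle>\<^bsub>cvec n\<^esub> = 0"
    then have "(\<Sum>i<n. (cmod (x i))\<^sup>2) = 0"
      unfolding hinner_cvec_self of_real_eq_0_iff by simp
    then have "x i = 0" if "i < n" for i
      using that by (simp add: sum_nonneg_eq_0_iff)
    then show "x = \<zero>\<^bsub>cvec n\<^esub>"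
      using x by (intro cvec_eqI[OF x]) (simp_all add: cvec_sel(1,2))
  next
    show "\<langle>x,x\<rangle>\<^bsub>cvec n\<^esub> \<in> \<real>\<^sub>\<ge>\<^sub>0" for x
      unfolding hinner_cvec_self nonneg_Reals_of_real_iff by (simp add: sum_nonneg)
  next
    show "\<langle>y,x\<rangle>\<^bsub>cvec n\<^esub> = cnj \<langle>x,y\<rangle>\<^bsub>cvec n\<^esub>" for x y
      by (simp add: cvec_sel(5) mult.commute)
    show "\<langle>x \<oplus>\<^bsub>cvec n\<^esub> y,z\<rangle>\<^bsub>cvec n\<^esub> = \<langle>x,z\<rangle>\<^bsub>cvec n\<^esub> + \<langle>y,z\<rangle>\<^bsub>cvec n\<^esub>" for x y z
      by (simp add: cvec_sel(3,5) distrib_right sum.distrib)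
    show "\<langle>c \<odot>\<^bsub>cvec n\<^esub> x,y\<rangle>\<^bsub>cvec n\<^esub> = c * \<langle>x,y\<rangle>\<^bsub>cvec n\<^esub>" for c x y
      by (simp add: cvec_sel(4,5) sum_distrib_left mult.assoc)
  qed (rule mcomplete_cvec separable_cvec)+
qed

section \<open>Operators as matrices, and their adjoints\<close>

text \<open>The restriction to the carrier makes the function extensional, as
  \<open>bounded_ops\<close> demands.\<close>

definition mat_op :: "nat \<Rightarrow> (nat \<Rightarrow> nat \<Rightarrow> complex) \<Rightarrow> (nat \<Rightarrow> complex) \<Rightarrow> nat \<Rightarrow> complex" where
  "mat_op n m = (\<lambda>x\<in>carrier (cvec n). \<lambda>i. if i < n then \<Sum>j<n. m i j * x j else 0)"

lemma mat_op_apply: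
  "x \<in> carrier (cvec n) \<Longrightarrow> mat_op n m x = (\<lambda>i. if i < n then \<Sum>j<n. m i j * x j else 0)"
  by (simp add: mat_op_def)

lemma mat_op_closed: "x \<in> carrier (cvec n) \<Longrightarrow> mat_op n m x \<in> carrier (cvec n)"
  by (simp add: mat_op_apply cvec_sel(1))

lemma mat_op_bounded: "mat_op n m \<in> bounded_ops (cvec n)"
proof -
  \<comment> \<open>The sum of the moduli of all entries serves as bound: the Euclidean norm is at
    most the sum of the moduli, and each coordinate is at most the norm.\<close>
  have "hnorm (cvec n) (mat_op n m x) \<le> (\<Sum>i<n. \<Sum>j<n. cmod (m i j)) * hnorm (cvec n) x"
    if x: "x \<in> carrier (cvec n)" for x
  proof -
    have "hnorm (cvec n) (mat_op n m x) \<le> (\<Sum>i<n. cmod (\<Sum>j<n. m i j * x j))"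
      unfolding hnorm_cvec by (rule order.trans[OF L2_set_le_sum]) (auto simp: x mat_op_apply)
    also have "\<dots> \<le> (\<Sum>i<n. \<Sum>j<n. cmod (m i j) * hnorm (cvec n) x)"
    proof (intro sum_mono order.trans[OF norm_sum])
      fix i j assume "j \<in> {..<n}"
      then have "cmod (x j) \<le> hnorm (cvec n) x"
        unfolding hnorm_cvec by (intro member_le_L2_set) auto
      then show "cmod (m i j * x j) \<le> cmod (m i j) * hnorm (cvec n) x"
        by (simp add: norm_mult mult_left_mono)
    qed
    finally show ?thesis by (simp add: sum_distrib_right)
  qed
  then have "\<exists>K. \<forall>x\<in>carrier (cvec n). hnorm (cvec n) (mat_op n m x) \<le> K * hnorm (cvec n) x"
    by blast
  moreover have "mat_op n m \<in> carrier (cvec n) \<rightarrow>\<^sub>E carrier (cvec n)"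
    using mat_op_closed by (auto simp: mat_op_def)
  moreover have "mat_op n m (x \<oplus>\<^bsub>cvec n\<^esub> y) = mat_op n m x \<oplus>\<^bsub>cvec n\<^esub> mat_op n m y"
    if "x \<in> carrier (cvec n)" "y \<in> carrier (cvec n)" for x y
    using that by (auto simp: mat_op_def cvec_sel sum.distrib distrib_left)
  moreover have "mat_op n m (c \<odot>\<^bsub>cvec n\<^esub> x) = c \<odot>\<^bsub>cvec n\<^esub> mat_op n m x"
    if "x \<in> carrier (cvec n)" for c x
    using that by (auto simp: mat_op_def cvec_sel sum_distrib_left mult.left_commute)
  ultimately show ?thesis
    unfolding bounded_ops_def by blast
qed

definition unit_vec :: "nat \<Rightarrow> nat \<Rightarrow> complex" where
  "unit_vec j = (\<lambda>i. if i = j then 1 else 0)"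

lemma unit_vec_carrier: "j < n \<Longrightarrow> unit_vec j \<in> carrier (cvec n)"
  by (simp add: unit_vec_def cvec_sel)

lemma mat_op_unit_vec: "\<lbrakk>i < n; j < n\<rbrakk> \<Longrightarrow> mat_op n m (unit_vec j) i = m i j"
  by (simp add: mat_op_apply unit_vec_carrier) (simp add: unit_vec_def if_distrib cong: if_cong)

text \<open>Unit vectors recover the entries. Every operator identity below is reduced to an
  entrywise one this way.\<close>

lemma mat_op_eq_iff: "mat_op n a = mat_op n b \<longleftrightarrow> (\<forall>i<n. \<forall>j<n. a i j = b i j)"
proof
  show "mat_op n a = mat_op n b \<Longrightarrow> \<forall>i<n. \<forall>j<n. a i j = b i j"
    by (metis mat_op_unit_vec)
  show "\<forall>i<n. \<forall>j<n. a i j = b i j \<Longrightarrow> mat_op n a = mat_op n b"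
    by (auto simp: mat_op_def fun_eq_iff intro!: sum.cong)
qed

text \<open>Used in the uniqueness halves of the definite descriptions of adjoint, square root and
  polar factor: any competitor is a matrix.\<close>

lemma bounded_op_is_mat_op:
  assumes T: "T \<in> bounded_ops (cvec n)"
  obtains m where "T = mat_op n m"
proof
  let ?m = "\<lambda>i j. T (unit_vec j) i"
  have Tc: "T x \<in> carrier (cvec n)" if "x \<in> carrier (cvec n)" for x
    using T that by (auto simp: bounded_ops_def)
  have add: "T (\<lambda>i. x i + y i) = (\<lambda>i. T x i + T y i)"
    if "x \<in> carrier (cvec n)" "y \<in> carrier (cvec n)" for x y
    using T that by (auto simp: bounded_ops_def cvec_sel(3))
  have smult: "T (\<lambda>i. c * x i) = (\<lambda>i. c * T x i)" if "x \<in> carrier (cvec n)" for c x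
    using T that by (auto simp: bounded_ops_def cvec_sel(4))
  \<comment> \<open>Additivity is available for two summands only, so the expansion in unit vectors
    is an induction on the number \<open>k\<close> of coordinates kept.\<close>
  have *: "T (\<lambda>i. if i < k then x i else 0) = (\<lambda>i. \<Sum>j<k. x j * ?m i j)" if "k \<le> n" for k x
    using that
  proof (induction k)
    case 0
    then show ?case using smult[of "\<lambda>_. 0" 0] by (simp add: cvec_sel)
  next
    case (Suc k)
    have "T (\<lambda>i. if i < Suc k then x i else 0)
        = T (\<lambda>i. (if i < k then x i else 0) + x k * unit_vec k i)"
      by (rule arg_cong[of _ _ T]) (auto simp: unit_vec_def fun_eq_iff less_Suc_eq)
    also have "\<dots> = (\<lambda>i. T (\<lambda>i. if i < k then x i else 0) i + x k * T (unit_vec k) i)"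
      using Suc.prems by (subst add) (auto simp: smult unit_vec_carrier, auto simp: cvec_sel unit_vec_def)
    finally show ?case using Suc by simp
  qed
  show "T = mat_op n ?m"
  proof
    fix x
    show "T x = mat_op n ?m x"
    proof (cases "x \<in> carrier (cvec n)")
      case True
      then have "x = (\<lambda>i. if i < n then x i else 0)" by (auto simp: cvec_sel)
      then have "T x = (\<lambda>i. \<Sum>j<n. x j * ?m i j)" using *[of n x] by simp
      then show ?thesis
        using True Tc[OF True] by (intro cvec_eqI[OF _ mat_op_closed]) (auto simp: mat_op_apply mult.commute)
    next
      case False
      \<comment> \<open>Off the carrier both functions are \<open>undefined\<close>.\<close>
      then show ?thesis using T by (auto simp: bounded_ops_def mat_op_def)
    qed
  qed
qed

lemma mat_op_compose:
  "compose (carrier (cvec n)) (mat_op n a) (mat_op n b) = mat_op n (\<lambda>i j. \<Sum>k<n. a i k * b k j)"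
proof
  fix x
  have "(\<Sum>k<n. a i k * (\<Sum>j<n. b k j * x j)) = (\<Sum>j<n. (\<Sum>k<n. a i k * b k j) * x j)" for i
    unfolding sum_distrib_left sum_distrib_right by (subst sum.swap) (simp add: mult.assoc)
  then show "compose (carrier (cvec n)) (mat_op n a) (mat_op n b) x
      = mat_op n (\<lambda>i j. \<Sum>k<n. a i k * b k j) x"
    by (auto simp: compose_def mat_op_closed mat_op_apply[of "mat_op n b x"])
      (auto simp: mat_op_def)
qed

lemma hinner_unit_vec: "i < n \<Longrightarrow> \<langle>x,unit_vec i\<rangle>\<^bsub>cvec n\<^esub> = x i"
  by (simp add: cvec_sel unit_vec_def if_distrib cong: if_cong)

lemma hinner_unit_vec_left: "i < n \<Longrightarrow> \<langle>unit_vec i,x\<rangle>\<^bsub>cvec n\<^esub> = cnj (x i)"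
  by (simp add: cvec_sel unit_vec_def if_distrib[of "\<lambda>a. a * b" for b] cong: if_cong)

lemma hinner_mat_op:
  assumes "x \<in> carrier (cvec n)" "y \<in> carrier (cvec n)"
  shows "\<langle>mat_op n m x,y\<rangle>\<^bsub>cvec n\<^esub> = \<langle>x,mat_op n (\<lambda>i j. cnj (m j i)) y\<rangle>\<^bsub>cvec n\<^esub>"
  using assms
  by (simp add: cvec_sel(5) mat_op_apply sum_distrib_left sum_distrib_right,
      subst sum.swap) (simp add: ac_simps)

text \<open>Existence is \<open>hinner_mat_op\<close>; uniqueness follows by testing the defining
  identity on pairs of unit vectors.\<close>

lemma adjoint_mat_op: "adjoint (cvec n) (mat_op n m) = mat_op n (\<lambda>i j. cnj (m j i))"
  unfolding adjoint_def
proof (rule the_equality)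
  fix S assume S: "S \<in> bounded_ops (cvec n) \<and> (\<forall>x\<in>carrier (cvec n). \<forall>y\<in>carrier (cvec n).
      \<langle>mat_op n m x,y\<rangle>\<^bsub>cvec n\<^esub> = \<langle>x,S y\<rangle>\<^bsub>cvec n\<^esub>)"
  then obtain s where s: "S = mat_op n s" using bounded_op_is_mat_op by blast
  have "s i j = cnj (m j i)" if ij: "i < n" "j < n" for i j
  proof -
    have "\<langle>mat_op n m (unit_vec i),unit_vec j\<rangle>\<^bsub>cvec n\<^esub> = \<langle>unit_vec i,mat_op n s (unit_vec j)\<rangle>\<^bsub>cvec n\<^esub>"
      using S ij by (simp add: s unit_vec_carrier)
    then show ?thesis
      using ij by (simp add: hinner_unit_vec hinner_unit_vec_left mat_op_unit_vec)
  qed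
  then show "S = mat_op n (\<lambda>i j. cnj (m j i))" by (simp add: s mat_op_eq_iff)
qed (simp add: mat_op_bounded hinner_mat_op)

section \<open>Diagonal matrices and positive square roots\<close>

definition diag :: "(nat \<Rightarrow> real) \<Rightarrow> nat \<Rightarrow> nat \<Rightarrow> complex" where
  "diag d = (\<lambda>i j. if i = j then of_real (d i) else 0)"

lemma sum_diag_left: "i < n \<Longrightarrow> (\<Sum>k<n. diag d i k * f k) = of_real (d i) * f i"
  by (simp add: diag_def if_distrib[of "\<lambda>a. a * b" for b] cong: if_cong)

lemma sum_diag_right: "j < n \<Longrightarrow> (\<Sum>k<n. f k * diag d k j) = f j * of_real (d j)"
  by (simp add: diag_def if_distrib cong: if_cong)

text \<open>
  The eigenvalues being distinct makes the square root unique by pure algebra: it commutes with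
  its square, hence is diagonal.
\<close>
lemma sqrt_op_diag:
  assumes pos: "\<And>i. i < n \<Longrightarrow> 0 \<le> d i" and inj: "inj_on d {..<n}"
  shows "sqrt_op (cvec n) (mat_op n (diag (\<lambda>i. (d i)\<^sup>2))) = mat_op n (diag d)"
  unfolding sqrt_op_def
proof (rule the_equality)
  have "\<langle>mat_op n (diag d) x,x\<rangle>\<^bsub>cvec n\<^esub> \<in> \<real>\<^sub>\<ge>\<^sub>0" if x: "x \<in> carrier (cvec n)" for x
  proof -
    have "\<langle>mat_op n (diag d) x,x\<rangle>\<^bsub>cvec n\<^esub> = of_real (\<Sum>i<n. d i * (cmod (x i))\<^sup>2)"
      using x by (simp add: cvec_sel(5) mat_op_apply sum_diag_left complex_norm_square mult.assoc
          del: of_real_power)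
    moreover have "0 \<le> (\<Sum>i<n. d i * (cmod (x i))\<^sup>2)"
      using pos by (intro sum_nonneg) simp
    ultimately show ?thesis by (simp only: nonneg_Reals_of_real_iff)
  qed
  then show "positive_op (cvec n) (mat_op n (diag d)) \<and>
      compose (carrier (cvec n)) (mat_op n (diag d)) (mat_op n (diag d)) = mat_op n (diag (\<lambda>i. (d i)\<^sup>2))"
    by (auto simp: positive_op_def mat_op_bounded mat_op_compose mat_op_eq_iff sum_diag_left)
      (auto simp: diag_def power2_eq_square)
next
  fix P assume P: "positive_op (cvec n) P \<and>
    compose (carrier (cvec n)) P P = mat_op n (diag (\<lambda>i. (d i)\<^sup>2))"
  then obtain p where p: "P = mat_op n p"
    using bounded_op_is_mat_op by (auto simp: positive_op_def)
  have sq: "(\<Sum>k<n. p i k * p k j) = diag (\<lambda>i. (d i)\<^sup>2) i j" if "i < n" "j < n" for i j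
    using P that by (simp add: p mat_op_compose mat_op_eq_iff)
  have "p i j = diag d i j" if ij: "i < n" "j < n" for i j
  proof -
    have off: "p i j = 0" if "i \<noteq> j" "i < n" "j < n" for i j
    proof -
      \<comment> \<open>The two bracketings of the cube of \<open>p\<close> agree, so
        \<open>p\<close> commutes with the diagonal matrix of the squares.\<close>
      have "(\<Sum>k<n. p i k * (\<Sum>l<n. p k l * p l j)) = (\<Sum>k<n. (\<Sum>l<n. p i l * p l k) * p k j)"
        unfolding sum_distrib_left sum_distrib_right by (subst sum.swap) (simp add: mult.assoc)
      then have "p i j * of_real ((d j)\<^sup>2) = of_real ((d i)\<^sup>2) * p i j"
        using that by (simp add: sq sum_diag_left sum_diag_right)
      moreover have "(d i)\<^sup>2 \<noteq> (d j)\<^sup>2"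
        using that inj pos by (auto simp: inj_on_def power2_eq_iff_nonneg)
      ultimately show ?thesis
        by (metis mult.commute mult_right_cancel of_real_eq_iff)
    qed
    show ?thesis
    proof (cases "i = j")
      case True
      have "(\<Sum>k<n. p i k * p k i) = (\<Sum>k<n. if k = i then p i i * p i i else 0)"
        using off ij by (intro sum.cong) auto
      then have "(p i i)\<^sup>2 = (of_real (d i))\<^sup>2"
        using sq[of i i] ij by (simp add: diag_def power2_eq_square)
      \<comment> \<open>Positivity on \<open>unit_vec i\<close> selects the nonnegative one of the
        two roots.\<close>
      moreover have "p i i \<in> \<real>\<^sub>\<ge>\<^sub>0"
      proof -
        have "\<langle>P (unit_vec i),unit_vec i\<rangle>\<^bsub>cvec n\<^esub> \<in> \<real>\<^sub>\<ge>\<^sub>0"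
          using P ij by (simp add: positive_op_def unit_vec_carrier)
        then show ?thesis using ij by (simp add: p hinner_unit_vec mat_op_unit_vec)
      qed
      ultimately have "p i i = of_real (d i)"
        using pos[of i] ij
        by (auto simp: power2_eq_iff complex_eq_iff complex_nonneg_Reals_iff)
      then show ?thesis using True by (simp add: diag_def)
    qed (use off ij in \<open>simp add: diag_def\<close>)
  qed
  then show "P = mat_op n (diag d)" by (simp add: p mat_op_eq_iff)
qed

section \<open>Polar decomposition and Duggal transform of a unitary times a diagonal matrix\<close>

text \<open>Below, W is the matrix \<open>w\<close> and D the diagonal matrix of \<open>d\<close>.
  Distinct weights are what \<open>sqrt_op_diag\<close> asks for; one of them may be 0, which gives
  a kernel of dimension one.\<close>

locale weighted_unitary =
  fixes n :: nat and w :: "nat \<Rightarrow> nat \<Rightarrow> complex" and d :: "nat \<Rightarrow> real"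
  assumes unitary:
      "\<lbrakk>i < n; j < n\<rbrakk> \<Longrightarrow> (\<Sum>k<n. cnj (w k i) * w k j) = (if i = j then 1 else 0)"
    and weight_nonneg: "i < n \<Longrightarrow> 0 \<le> d i"
    and weight_inj: "inj_on d {..<n}"
begin

text \<open>The product of W and diag(a): a = \<open>d\<close> gives T, and a = \<open>supp\<close>
  gives its polar factor.\<close>

definition scaled :: "(nat \<Rightarrow> real) \<Rightarrow> nat \<Rightarrow> nat \<Rightarrow> complex" where
  "scaled a = (\<lambda>i j. w i j * of_real (a j))"

text \<open>The diagonal of the projection P onto the range of D.\<close>

definition supp :: "nat \<Rightarrow> real" where
  "supp = (\<lambda>j. if d j = 0 then 0 else 1)"

lemma mat_op_scaled:
  "x \<in> carrier (cvec n) \<Longrightarrow> mat_op n (scaled a) x = mat_op n w (\<lambda>i. of_real (a i) * x i)"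
  by (subst (1 2) mat_op_apply) (auto simp: cvec_sel scaled_def mult.assoc)

lemma adjoint_unitary:
  assumes "y \<in> carrier (cvec n)"
  shows "mat_op n (\<lambda>i j. cnj (w j i)) (mat_op n w y) = y"
proof -
  have "mat_op n (\<lambda>i j. cnj (w j i)) (mat_op n w y) =
      compose (carrier (cvec n)) (mat_op n (\<lambda>i j. cnj (w j i))) (mat_op n w) y"
    using assms by (simp add: compose_eq)
  also have "\<dots> = mat_op n (diag (\<lambda>_. 1)) y"
    by (rule fun_cong[of _ _ y]) (simp add: mat_op_compose mat_op_eq_iff unitary diag_def)
  also have "\<dots> = y"
    using assms by (auto simp: mat_op_apply sum_diag_left cvec_sel)
  finally show ?thesis .
qed

lemma hinner_unitary:
  assumes "x \<in> carrier (cvec n)" "y \<in> carrier (cvec n)"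
  shows "\<langle>mat_op n w x,mat_op n w y\<rangle>\<^bsub>cvec n\<^esub> = \<langle>x,y\<rangle>\<^bsub>cvec n\<^esub>"
  using assms by (simp add: hinner_mat_op mat_op_closed adjoint_unitary)

text \<open>W is injective, so only the zeros of \<open>a\<close> count; hence W D and W P have the
  same kernel.\<close>

lemma ker_op_scaled:
  "ker_op (cvec n) (mat_op n (scaled a)) = {x \<in> carrier (cvec n). \<forall>i<n. a i = 0 \<or> x i = 0}"
proof -
  have "mat_op n (scaled a) x = \<zero>\<^bsub>cvec n\<^esub> \<longleftrightarrow> (\<forall>i<n. a i = 0 \<or> x i = 0)"
    if x: "x \<in> carrier (cvec n)" for x
  proof -
    let ?z = "\<lambda>i. of_real (a i) * x i"
    have z: "?z \<in> carrier (cvec n)" using x by (simp add: cvec_sel)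
    have zero: "mat_op n m (\<lambda>_. 0) = (\<lambda>_. 0)" for m
      by (simp add: mat_op_apply cvec_sel(1) fun_eq_iff)
    have "mat_op n w ?z = (\<lambda>_. 0) \<longleftrightarrow> ?z = (\<lambda>_. 0)"
    proof
      assume "mat_op n w ?z = (\<lambda>_. 0)"
      then show "?z = (\<lambda>_. 0)"
        using adjoint_unitary[OF z] zero by simp
    qed (simp only: zero)
    also have "\<dots> \<longleftrightarrow> (\<forall>i<n. a i = 0 \<or> x i = 0)"
      using x unfolding cvec_sel fun_eq_iff by (auto simp: not_less[symmetric])
    finally show ?thesis
      using x by (simp add: mat_op_scaled cvec_sel(2))
  qed
  then show ?thesis by (auto simp: ker_op_def)
qed

text \<open>T* T = D W* W D is the square of D.\<close>

lemma abs_op_scaled: "abs_op (cvec n) (mat_op n (scaled d)) = mat_op n (diag d)"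
proof -
  have "(\<Sum>k<n. cnj (scaled d k i) * scaled d k j) = diag (\<lambda>i. (d i)\<^sup>2) i j"
    if "i < n" "j < n" for i j
  proof -
    have "(\<Sum>k<n. cnj (scaled d k i) * scaled d k j)
        = of_real (d i * d j) * (\<Sum>k<n. cnj (w k i) * w k j)"
      by (simp add: scaled_def sum_distrib_left mult_ac)
    then show ?thesis
      using that by (simp add: unitary diag_def power2_eq_square)
  qed
  then have "compose (carrier (cvec n)) (adjoint (cvec n) (mat_op n (scaled d))) (mat_op n (scaled d))
      = mat_op n (diag (\<lambda>i. (d i)\<^sup>2))"
    by (simp add: adjoint_mat_op mat_op_compose mat_op_eq_iff)
  then show ?thesis
    by (simp add: abs_op_def sqrt_op_diag weight_nonneg weight_inj)
qed

text \<open>A vector orthogonal to the kernel is orthogonal to the unit vectors in it, so P fixes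
  it, and W preserves norms.\<close>

lemma partial_isometry_scaled_supp: "partial_isometry (cvec n) (mat_op n (scaled supp))"
  unfolding partial_isometry_def
proof (intro conjI ballI mat_op_bounded)
  fix x assume x: "x \<in> orth_compl (cvec n) (ker_op (cvec n) (mat_op n (scaled supp)))"
  then have xc: "x \<in> carrier (cvec n)" by (simp add: orth_compl_def)
  have "x j = 0" if "j < n" "supp j = 0" for j
  proof -
    have "unit_vec j \<in> ker_op (cvec n) (mat_op n (scaled supp))"
      using that by (simp add: ker_op_scaled unit_vec_carrier) (simp add: unit_vec_def)
    then show ?thesis using x that by (auto simp: orth_compl_def hinner_unit_vec)
  qed
  then have "of_real (supp j) * x j = x j" for j
    using xc by (cases "j < n") (auto simp: supp_def cvec_sel split: if_splits)
  then have "(\<lambda>j. of_real (supp j) * x j) = x" by blast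
  then show "hnorm (cvec n) (mat_op n (scaled supp) x) = hnorm (cvec n) x"
    using xc by (simp add: hnorm_def mat_op_scaled hinner_unitary)
qed

text \<open>For uniqueness, column \<open>j\<close> of a competitor is found from T = U D by
  division if \<open>d j\<close> is nonzero, and is zero by the kernel condition otherwise.\<close>

lemma polar_factor_scaled: "polar_factor (cvec n) (mat_op n (scaled d)) = mat_op n (scaled supp)"
  unfolding polar_factor_def
proof (rule the_equality)
  show "partial_isometry (cvec n) (mat_op n (scaled supp)) \<and>
      ker_op (cvec n) (mat_op n (scaled supp)) = ker_op (cvec n) (mat_op n (scaled d)) \<and>
      mat_op n (scaled d) =
        compose (carrier (cvec n)) (mat_op n (scaled supp)) (abs_op (cvec n) (mat_op n (scaled d)))"
    by (auto simp: partial_isometry_scaled_supp ker_op_scaled abs_op_scaled mat_op_compose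
        mat_op_eq_iff sum_diag_right)
      (auto simp: scaled_def supp_def split: if_splits)
next
  fix U assume U: "partial_isometry (cvec n) U \<and>
    ker_op (cvec n) U = ker_op (cvec n) (mat_op n (scaled d)) \<and>
    mat_op n (scaled d) = compose (carrier (cvec n)) U (abs_op (cvec n) (mat_op n (scaled d)))"
  then obtain u where u: "U = mat_op n u"
    using bounded_op_is_mat_op by (auto simp: partial_isometry_def)
  have "u i j = scaled supp i j" if ij: "i < n" "j < n" for i j
  proof (cases "d j = 0")
    case True
    have "unit_vec j \<in> ker_op (cvec n) (mat_op n (scaled d))"
      using ij True by (simp add: ker_op_scaled unit_vec_carrier) (simp add: unit_vec_def)
    then have "mat_op n u (unit_vec j) = \<zero>\<^bsub>cvec n\<^esub>"
      using U by (auto simp: u ker_op_def)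
    then have "u i j = 0"
      using mat_op_unit_vec[OF ij, of u] by (simp add: cvec_sel)
    then show ?thesis using True by (simp add: scaled_def supp_def)
  next
    case False
    have "scaled d i j = u i j * of_real (d j)"
      using U ij by (simp add: u abs_op_scaled mat_op_compose mat_op_eq_iff sum_diag_right)
    then show ?thesis using False by (simp add: scaled_def supp_def)
  qed
  then show "U = mat_op n (scaled supp)" by (simp add: u mat_op_eq_iff)
qed

lemma duggal_scaled:
  "duggal (cvec n) (mat_op n (scaled d)) = mat_op n (\<lambda>i j. of_real (d i) * scaled supp i j)"
  by (simp add: duggal_def abs_op_scaled polar_factor_scaled mat_op_compose mat_op_eq_iff
      sum_diag_left)

lemma complex_symmetric_scaled:
  assumes sym: "\<And>i j. \<lbrakk>i < n; j < n\<rbrakk> \<Longrightarrow> w i j = w j i"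
  shows "complex_symmetric (cvec n) (mat_op n (scaled d))"
proof -
  define C where "C = (\<lambda>x. mat_op n w (\<lambda>i. cnj (x i)))"
  have cnjc: "(\<lambda>i. cnj (x i)) \<in> carrier (cvec n)" if "x \<in> carrier (cvec n)" for x
    using that by (simp add: cvec_sel)
  \<comment> \<open>The symmetry of \<open>w\<close> enters here: the entrywise conjugate of W is
    W*. Then C is an involution because W* W = I.\<close>
  have cnj_C: "(\<lambda>i. cnj (C x i)) = mat_op n (\<lambda>i j. cnj (w j i)) x"
    if "x \<in> carrier (cvec n)" for x
    using that cnjc[OF that] by (auto simp: C_def mat_op_apply sym intro!: sum.cong)
  have CC: "C (C x) = x" if x: "x \<in> carrier (cvec n)" for x
  proof -
    have "(\<lambda>i. cnj (C (C x) i)) = mat_op n (\<lambda>i j. cnj (w j i)) (C x)"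
      using cnj_C[of "C x"] cnjc[OF x] by (simp add: C_def mat_op_closed)
    also have "\<dots> = (\<lambda>i. cnj (x i))"
      using cnjc[OF x] by (simp add: C_def adjoint_unitary)
    finally show ?thesis by (simp add: fun_eq_iff)
  qed
  have "conjugation (cvec n) C"
    unfolding conjugation_def
  proof (intro conjI ballI allI)
    fix x y assume xy: "x \<in> carrier (cvec n)" "y \<in> carrier (cvec n)"
    show "C (x \<oplus>\<^bsub>cvec n\<^esub> y) = C x \<oplus>\<^bsub>cvec n\<^esub> C y"
      using xy by (auto simp: C_def mat_op_apply cvec_sel sum.distrib algebra_simps)
    show "\<langle>C x,C y\<rangle>\<^bsub>cvec n\<^esub> = \<langle>y,x\<rangle>\<^bsub>cvec n\<^esub>"
      unfolding C_def using xy cnjc by (subst hinner_unitary) (auto simp: cvec_sel(5) mult.commute)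
  next
    fix c x assume "x \<in> carrier (cvec n)"
    then show "C (c \<odot>\<^bsub>cvec n\<^esub> x) = cnj c \<odot>\<^bsub>cvec n\<^esub> C x"
      by (auto simp: C_def mat_op_apply cvec_sel sum_distrib_left algebra_simps)
  qed (auto simp: C_def cnjc mat_op_closed CC[unfolded C_def])
  moreover have "mat_op n (scaled d) x = C (adjoint (cvec n) (mat_op n (scaled d)) (C x))"
    if x: "x \<in> carrier (cvec n)" for x
  proof -
    have Cx: "C x \<in> carrier (cvec n)" using cnjc[OF x] by (simp add: C_def mat_op_closed)
    \<comment> \<open>As D is real, T* = D W*, so T* C x = D W* W (cnj x) = D (cnj x). Applying C
      turns this into W D x.\<close>
    have "adjoint (cvec n) (mat_op n (scaled d)) (C x)
        = (\<lambda>i. of_real (d i) * mat_op n (\<lambda>i j. cnj (w j i)) (C x) i)"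
      using Cx by (auto simp: adjoint_mat_op mat_op_apply scaled_def sum_distrib_left mult_ac)
    also have "\<dots> = (\<lambda>i. of_real (d i) * cnj (x i))"
      using cnjc[OF x] by (simp add: C_def adjoint_unitary)
    finally show ?thesis using x by (simp add: C_def mat_op_scaled)
  qed
  ultimately show ?thesis unfolding complex_symmetric_def by blast
qed

end

section \<open>The example in dimension four\<close>

text \<open>This is I - J/2 with J the all-ones matrix: real, symmetric and its own inverse.\<close>

definition refl4 :: "nat \<Rightarrow> nat \<Rightarrow> complex" where
  "refl4 i j = (if i = j then 1 / 2 else - 1 / 2)"

text \<open>With e = (2,3,4,0), the first three coordinates of W e are -5/2, -3/2, -1/2; the nonzero
  weights turn them into -5 times those of e. The last weight creates the kernel.\<close>

definition weight4 :: "nat \<Rightarrow> real" where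
  "weight4 i = (if i = 0 then 4 else if i = 1 then 10 else if i = 2 then 40 else 0)"

lemma sum_lessThan_4: "(\<Sum>i<4. f i) = f 0 + f 1 + f 2 + f (3::nat)"
  by (simp add: eval_nat_numeral)

lemma less_4_cases: "i < 4 \<longleftrightarrow> i = 0 \<or> i = 1 \<or> i = 2 \<or> i = (3::nat)"
  by auto

interpretation ex4: weighted_unitary 4 refl4 weight4
proof
  show "(\<Sum>k<4. cnj (refl4 k i) * refl4 k j) = (if i = j then 1 else 0)" if "i < 4" "j < 4" for i j
    using that unfolding less_4_cases sum_lessThan_4
    by (elim disjE) (simp_all add: refl4_def)
  show "0 \<le> weight4 i" for i by (simp add: weight4_def)
  show "inj_on weight4 {..<4}"
    by (auto simp: inj_on_def less_4_cases weight4_def split: if_splits)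
qed

text \<open>
  The Duggal transform A has the simple eigenvalue -5, with eigenvector e = (2,3,4,0) for A and
  f = (5,3,1,0) for the adjoint B. A conjugation C with A = C B C maps e to a multiple of f and
  B e to A (C e). But the squared norm of B e is 16763/29 times that of e, while the squared norm
  of A f is 19829/35 times that of f. The weights were found by prescribing e and solving for them.
\<close>
lemma not_complex_symmetric_duggal:
  "\<not> complex_symmetric (cvec 4) (duggal (cvec 4) (mat_op 4 (ex4.scaled weight4)))"
proof
  let ?H = "cvec 4" and ?A = "duggal (cvec 4) (mat_op 4 (ex4.scaled weight4))"
  let ?B = "adjoint ?H ?A"
  have A: "?A x = (\<lambda>i. if i = 0 then 2 * (x 0 - x 1 - x 2) else if i = 1 then 5 * (x 1 - x 0 - x 2)
      else if i = 2 then 20 * (x 2 - x 0 - x 1) else 0)" (is "_ = ?r") if "x \<in> carrier ?H" for x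
  proof (rule cvec_eqI[of _ 4])
    fix i :: nat assume "i < 4"
    then show "?A x i = ?r i"
      using that unfolding less_4_cases ex4.duggal_scaled
      by (auto simp: mat_op_apply sum_lessThan_4 ex4.scaled_def ex4.supp_def refl4_def weight4_def
          algebra_simps)
  qed (use that in \<open>auto simp: ex4.duggal_scaled mat_op_closed, auto simp: cvec_sel\<close>)
  have B: "?B x = (\<lambda>i. if i = 0 then 2 * x 0 - 5 * x 1 - 20 * x 2
      else if i = 1 then 5 * x 1 - 2 * x 0 - 20 * x 2
      else if i = 2 then 20 * x 2 - 2 * x 0 - 5 * x 1 else 0)" (is "_ = ?r")
    if "x \<in> carrier ?H" for x
  proof (rule cvec_eqI[of _ 4])
    fix i :: nat assume "i < 4"
    then show "?B x i = ?r i"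
      using that unfolding less_4_cases ex4.duggal_scaled adjoint_mat_op
      by (auto simp: mat_op_apply sum_lessThan_4 ex4.scaled_def ex4.supp_def refl4_def weight4_def
          algebra_simps)
  qed (use that in \<open>auto simp: ex4.duggal_scaled adjoint_mat_op mat_op_closed, auto simp: cvec_sel\<close>)
  assume "complex_symmetric ?H ?A"
  then obtain C where C: "conjugation ?H C" and AC: "\<And>x. x \<in> carrier ?H \<Longrightarrow> ?A x = C (?B (C x))"
    unfolding complex_symmetric_def by blast
  have Cc: "C x \<in> carrier ?H" and CC: "C (C x) = x" if "x \<in> carrier ?H" for x
    using C that by (auto simp: conjugation_def)
  have Bc: "?B x \<in> carrier ?H" if "x \<in> carrier ?H" for x
    using that by (simp add: ex4.duggal_scaled adjoint_mat_op mat_op_closed)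
  have hC: "\<langle>C x,C x\<rangle>\<^bsub>?H\<^esub> = \<langle>x,x\<rangle>\<^bsub>?H\<^esub>" if "x \<in> carrier ?H" for x
    using C that by (auto simp: conjugation_def)
  define e :: "nat \<Rightarrow> complex" where
    "e = (\<lambda>i. if i = 0 then 2 else if i = 1 then 3 else if i = 2 then 4 else 0)"
  have e: "e \<in> carrier ?H" by (simp add: e_def cvec_sel)
  define y where "y = C e"
  have y: "y \<in> carrier ?H" unfolding y_def using e by (rule Cc)
  have "?A e = (-5) \<odot>\<^bsub>?H\<^esub> e"
    unfolding A[OF e] by (auto simp: e_def cvec_sel)
  \<comment> \<open>The eigenvalue is real, so the antilinear \<open>C\<close> keeps it.\<close>
  then have "C (?A e) = (-5) \<odot>\<^bsub>?H\<^esub> y"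
    using C e by (simp add: conjugation_def y_def)
  moreover have "C (?A e) = ?B y"
    using AC[OF e] CC Bc y by (simp add: y_def)
  ultimately have "?B y i = -5 * y i" for i
    by (simp add: cvec_sel)
  \<comment> \<open>Simplicity of the eigenvalue: two of the equations already force
    \<open>y\<close> to be \<open>y 2\<close> times (5,3,1,0), where the last coordinate vanishes
    because the eigenvalue is nonzero.\<close>
  from this[of 0] this[of 1] this[of 2] this[of 3]
  have "7 * y 0 = 5 * y 1 + 20 * y 2" "10 * y 1 = 2 * y 0 + 20 * y 2" and y3: "y 3 = 0"
    by (simp_all add: B[OF y] algebra_simps)
  then have y1: "y 1 = 3 * y 2" and y0: "y 0 = 5 * y 2" by (simp_all add: complex_eq_iff)
  have "?A y = C (?B e)" using AC[OF y] e by (simp add: y_def CC)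
  then have "\<langle>?A y,?A y\<rangle>\<^bsub>?H\<^esub> = \<langle>?B e,?B e\<rangle>\<^bsub>?H\<^esub>" using hC[OF Bc[OF e]] by simp
  moreover have "?A y = (\<lambda>i. if i = 0 then 2 * y 2 else if i = 1 then -15 * y 2
      else if i = 2 then -140 * y 2 else 0)"
    unfolding A[OF y] y0 y1 by auto
  moreover have "?B e = (\<lambda>i. if i = 0 then -91 else if i = 1 then -69 else if i = 2 then 61 else 0)"
    unfolding B[OF e] by (auto simp: e_def)
  ultimately have "19829 * (y 2 * cnj (y 2)) = 16763"
    by (simp add: cvec_sel(5) sum_lessThan_4)
  \<comment> \<open>Since \<open>C\<close> preserves norms, \<open>y\<close> and \<open>e\<close>
    have the same norm. This gives a second value for the squared modulus of \<open>y 2\<close>,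
    which contradicts the first.\<close>
  moreover have "35 * (y 2 * cnj (y 2)) = 29"
    using hC[OF e] unfolding y_def[symmetric] cvec_sel(5) sum_lessThan_4 y0 y1 y3
    by (simp add: e_def)
  then have "y 2 * cnj (y 2) = 29 / 35"
    by (simp only: eq_divide_eq mult.commute[of _ 35]) simp
  ultimately show False by simp
qed

theorem mainTheorem1:
  shows "\<exists>(H :: (nat \<Rightarrow> complex) inner_module) T.
    separable_complex_hilbert_space H \<and> T \<in> bounded_ops H \<and>
    complex_symmetric H T \<and> \<not> complex_symmetric H (duggal H T)"
proof (intro exI conjI)
  show "separable_complex_hilbert_space (cvec 4)"
    by (rule separable_complex_hilbert_space_cvec)
  show "mat_op 4 (ex4.scaled weight4) \<in> bounded_ops (cvec 4)"
    by (rule mat_op_bounded)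
  show "complex_symmetric (cvec 4) (mat_op 4 (ex4.scaled weight4))"
    by (rule ex4.complex_symmetric_scaled) (simp add: refl4_def)
  show "\<not> complex_symmetric (cvec 4) (duggal (cvec 4) (mat_op 4 (ex4.scaled weight4)))"
    by (rule not_complex_symmetric_duggal)
qed

end
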